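(* Let $n \geq 2$ be an integer and $S \subseteq \{1, \dots, \lfloor n/2 \rfloor\}$. For every vertex $v$ of $\mathsf{Circ}(n,S)$: if $n \equiv 0 \pmod 3$ and $\frac{n}{3} \in S$, then $e(v) \equiv 1 \pmod 3$; otherwise $e(v) \equiv 0 \pmod 3$.
   Context: For an integer $n \geq 2$ and $S \subseteq \{1, \dots, \lfloor n/2 \rfloor\}$, the circulant $\mathsf{Circ}(n,S)$ is the Cayley graph of $\mathbb{Z}_n$ with connection set $S \cup -S$: vertex set $\mathbb{Z}_n$, with $u$ and $w$ adjacent iff $w - u \in S \cup -S$. For a vertex $v$, $e(v)$ denotes the number of edges of the subgraph induced by the open neighbourhood of $v$. *)

theory Defs
  imports "HOL-Algebra.Elementary_Groups" "HOL-Number_Theory.Cong"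
begin

text \<open>Undirected graphs: an edge is an unordered pair, represented by the set of its endpoints.\<close>

record 'a ugraph =
  vertices :: "'a set"
  edges :: "'a set set"

definition open_neighbourhood :: "'a ugraph \<Rightarrow> 'a \<Rightarrow> 'a set" where
  "open_neighbourhood \<Gamma> v = {w \<in> vertices \<Gamma>. {v, w} \<in> edges \<Gamma>}"

definition induced_subgraph :: "'a ugraph \<Rightarrow> 'a set \<Rightarrow> 'a ugraph" where
  "induced_subgraph \<Gamma> X =
     \<lparr>vertices = vertices \<Gamma> \<inter> X, edges = {E \<in> edges \<Gamma>. E \<subseteq> X}\<rparr>"

definition neighbourhood_edges :: "'a ugraph \<Rightarrow> 'a \<Rightarrow> nat" where
  "neighbourhood_edges \<Gamma> v = card (edges (induced_subgraph \<Gamma> (open_neighbourhood \<Gamma> v)))"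

text \<open>
  Intended for inverse-closed connection sets \<open>C\<close> that do not contain the identity; then
  the adjacency relation is symmetric and there are no loops. In additive notation,
  \<open>w \<otimes> inv u\<close> is \<open>w - u\<close>.
\<close>

definition cayley_graph :: "('a, 'b) monoid_scheme \<Rightarrow> 'a set \<Rightarrow> 'a ugraph" where
  "cayley_graph G C =
     \<lparr>vertices = carrier G,
      edges = {{u, w} | u w. u \<in> carrier G \<and> w \<in> carrier G \<and> w \<otimes>\<^bsub>G\<^esub> inv\<^bsub>G\<^esub> u \<in> C}\<rparr>"

text \<open>
  \<open>integer_mod_group n\<close> has carrier \<open>{0..<int n}\<close> for \<open>n > 0\<close>, so a set
  \<open>S \<subseteq> {1..n div 2}\<close> with \<open>n \<ge> 2\<close> consists of representatives of nonzero residue classes.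
\<close>

definition circulant :: "nat \<Rightarrow> nat set \<Rightarrow> int ugraph" where
  "circulant n S =
     (let Z = integer_mod_group n; T = int ` S in cayley_graph Z (T \<union> m_inv Z ` T))"

lemma circulant_adjacent_iff:
  assumes n: "n \<ge> 2" and S: "S \<subseteq> {1..n div 2}"
    and u: "u \<in> {0..<int n}" and w: "w \<in> {0..<int n}"
  shows "{u, w} \<in> edges (circulant n S) \<longleftrightarrow>
    (\<exists>s\<in>S. [w - u = int s] (mod int n) \<or> [w - u = - int s] (mod int n))"
proof -
  let ?Z = "integer_mod_group n"
  have car: "carrier ?Z = {0..<int n}"
    using n by (simp add: carrier_integer_mod_group)
  have S': "int s \<in> carrier ?Z" "int s mod int n = int s" if "s \<in> S" for s
  proof -
    have "s \<in> {1..n div 2}" using that S by blast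
    with n have "s < n" by auto
    then show "int s \<in> carrier ?Z" "int s mod int n = int s" by (auto simp: car)
  qed
  have C: "(x \<otimes>\<^bsub>?Z\<^esub> inv\<^bsub>?Z\<^esub> y \<in> int ` S \<union> m_inv ?Z ` int ` S) \<longleftrightarrow>
      (\<exists>s\<in>S. [x - y = int s] (mod int n) \<or> [x - y = - int s] (mod int n))"
    if "y \<in> {0..<int n}" for x y
  proof -
    have "x \<otimes>\<^bsub>?Z\<^esub> inv\<^bsub>?Z\<^esub> y = (x - y) mod int n"
      using that by (simp add: car mod_add_right_eq)
    moreover have "m_inv ?Z ` int ` S = (\<lambda>s. (- int s) mod int n) ` S"
      using S' by (auto simp: image_image intro!: image_cong)
    ultimately show ?thesis
      using S' by (auto simp: cong_def image_iff)
  qed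
  have neg: "[u - w = a] (mod int n) \<longleftrightarrow> [w - u = - a] (mod int n)" for a
    using cong_minus_minus_iff[of "u - w" a "int n"] by simp
  have "{u, w} \<in> edges (circulant n S) \<longleftrightarrow>
      w \<otimes>\<^bsub>?Z\<^esub> inv\<^bsub>?Z\<^esub> u \<in> int ` S \<union> m_inv ?Z ` int ` S \<or>
      u \<otimes>\<^bsub>?Z\<^esub> inv\<^bsub>?Z\<^esub> w \<in> int ` S \<union> m_inv ?Z ` int ` S"
    using u w unfolding circulant_def Let_def cayley_graph_def car
    by (simp only: ugraph.simps mem_Collect_eq doubleton_eq_iff) blast
  also have "\<dots> \<longleftrightarrow> (\<exists>s\<in>S. [w - u = int s] (mod int n) \<or> [w - u = - int s] (mod int n))"
    unfolding C[OF u] C[OF w] by (auto simp: neg)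
  finally show ?thesis .
qed

end

theory Submission
  imports Defs
begin

text \<open>
  Ordered pairs \<open>(u, w)\<close> of adjacent neighbours of \<open>v\<close> correspond to triples
  \<open>(x, y, z) = (u - v, w - u, v - w)\<close> of elements of \<open>S \<union> -S\<close> with sum zero, and their number is
  \<open>2 e(v)\<close>. Rotating the triples is an action of a group of order three, so modulo three only the
  fixed triples \<open>x = y = z\<close> count. These satisfy \<open>3 x = 0\<close> with \<open>x \<noteq> 0\<close>, so they exist only if
  \<open>n = 3 m\<close> with \<open>m \<in> S\<close>, and then there are two of them, \<open>x = m\<close> and \<open>x = -m\<close>.
\<close>

section \<open>Counting tools: orbits of size three and fibres of size two\<close>

text \<open>The points moved by \<open>f\<close> split into disjoint orbits of exactly three
  elements, so they contribute a multiple of three.\<close>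

lemma card_cong_fixpoints_order_three:
  assumes fin: "finite A" and closed: "\<And>x. x \<in> A \<Longrightarrow> f x \<in> A"
    and order: "\<And>x. x \<in> A \<Longrightarrow> f (f (f x)) = x"
  shows "[card A = card {x \<in> A. f x = x}] (mod 3)"
proof -
  let ?F = "{x \<in> A. f x = x}"
  let ?orbit = "\<lambda>x. {x, f x, f (f x)}"
  let ?C = "?orbit ` (A - ?F)"
  have moved: "f x \<in> A - ?F" if "x \<in> A - ?F" for x
    using that closed order[of x] by auto
  have Un: "\<Union>?C = A - ?F"
    using moved by blast
  have "3 * card ?C = card (\<Union>?C)"
  proof (rule card_partition)
    show "finite ?C" "finite (\<Union>?C)"
      using fin unfolding Un by auto
    show "card c = 3" if "c \<in> ?C" for c
    proof -
      from that obtain x where x: "x \<in> A" "f x \<noteq> x" and c: "c = ?orbit x"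
        by auto
      \<comment> \<open>Applying \<open>f\<close> to either coincidence and using
        \<open>f (f (f x)) = x\<close> would force \<open>f x = x\<close>.\<close>
      have "f (f x) \<noteq> x" "f (f x) \<noteq> f x"
        using x order[of x] by metis+
      with x show ?thesis
        by (simp add: c eq_commute[of x])
    qed
    show "c \<inter> d = {}" if cd: "c \<in> ?C" "d \<in> ?C" "c \<noteq> d" for c d
    proof -
      \<comment> \<open>Every point of an orbit generates the whole orbit, so orbits that share a
        point coincide.\<close>
      have orbit_eq: "?orbit y = ?orbit x" if "x \<in> A" "y \<in> ?orbit x" for x y
        using that order[of x] by auto
      show ?thesis
      proof (rule ccontr)
        assume "c \<inter> d \<noteq> {}"
        then obtain y where y: "y \<in> c" "y \<in> d"
          by blast
        obtain x x' where x: "x \<in> A" "c = ?orbit x" and x': "x' \<in> A" "d = ?orbit x'"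
          using cd(1,2) by blast
        have "?orbit y = c" "?orbit y = d"
          using orbit_eq[of x y] orbit_eq[of x' y] x x' y by auto
        with \<open>c \<noteq> d\<close> show False
          by simp
      qed
    qed
  qed
  moreover have "card A = card ?F + card (A - ?F)"
    using fin by (metis (no_types, lifting) card_Diff_subset card_mono finite_subset
        le_add_diff_inverse mem_Collect_eq subsetI)
  ultimately have "card A = card ?F + 3 * card ?C"
    unfolding Un by simp
  then show ?thesis
    by (simp add: cong_def)
qed

text \<open>A two-element set \<open>{a, b}\<close> comes from exactly the ordered pairs
  \<open>(a, b)\<close> and \<open>(b, a)\<close>, and different edges have disjoint fibres.\<close>

lemma card_ordered_pairs_eq_twice:
  assumes fin: "finite F" and two: "\<And>E. E \<in> F \<Longrightarrow> card E = 2"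
  shows "card {(u, w). {u, w} \<in> F} = 2 * card F"
proof -
  let ?P = "\<lambda>E. {(u, w). {u, w} = E}"
  have c2: "card (?P E) = 2" if E: "E \<in> F" for E
  proof -
    obtain a b where ab: "E = {a, b}" "a \<noteq> b"
      using two[OF E] by (auto simp: card_2_iff)
    then have "?P E = {(a, b), (b, a)}"
      by (auto simp: doubleton_eq_iff)
    with ab show ?thesis by simp
  qed
  have "{(u, w). {u, w} \<in> F} = (\<Union>E\<in>F. ?P E)"
    by auto
  also have "card \<dots> = (\<Sum>E\<in>F. card (?P E))"
  proof (rule card_UN_disjoint[OF fin])
    show "\<forall>E\<in>F. finite (?P E)"
      \<comment> \<open>An infinite set has \<open>card\<close> 0 by convention, so cardinality 2
        already gives finiteness.\<close>
      using c2 card.infinite by fastforce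
  qed auto
  also have "\<dots> = 2 * card F"
    by (simp add: c2)
  finally show ?thesis .
qed

section \<open>Connection differences of a circulant\<close>

text \<open>Phrased by congruences for arbitrary integers, so that differences of vertices need not
  first be reduced to representatives.\<close>

definition circ_diff :: "nat \<Rightarrow> nat set \<Rightarrow> int \<Rightarrow> bool" where
  "circ_diff n S d \<longleftrightarrow> (\<exists>s\<in>S. [d = int s] (mod int n) \<or> [d = - int s] (mod int n))"

lemma circ_diff_cong:
  assumes "[d = d'] (mod int n)"
  shows "circ_diff n S d \<longleftrightarrow> circ_diff n S d'"
  using assms by (simp add: circ_diff_def cong_def)

lemma circ_diff_minus: "circ_diff n S (- d) \<longleftrightarrow> circ_diff n S d"
proof -
  have "[- d = a] (mod int n) \<longleftrightarrow> [d = - a] (mod int n)" for a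
    using cong_minus_minus_iff[of d "- a" "int n"] by simp
  then show ?thesis
    unfolding circ_diff_def by auto
qed

text \<open>This rules out loops: each element of \<open>S\<close> is positive and too small to be a
  multiple of \<open>n\<close>.\<close>

lemma not_circ_diff_0:
  assumes "S \<subseteq> {1..n div 2}"
  shows "\<not> circ_diff n S 0"
proof
  assume "circ_diff n S 0"
  then obtain s where s: "s \<in> S" "int n dvd int s"
    by (auto simp: circ_diff_def cong_iff_dvd_diff)
  with assms have "1 \<le> s" "s \<le> n div 2"
    by auto
  moreover have "n dvd s"
    using s by simp
  ultimately show False
    using dvd_imp_le[of n s] by linarith
qed

text \<open>If \<open>d\<close> is congruent to \<open>s\<close> or \<open>- s\<close>, then
  \<open>3 * s = n * k\<close> with \<open>k\<close> positive. Since \<open>2 * s <= n\<close>,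
  having \<open>k >= 2\<close> would give \<open>3 * s >= 2 * n >= 4 * s\<close>, impossible for
  \<open>s >= 1\<close>; hence \<open>k = 1\<close>.\<close>

lemma circ_diff_three_torsion:
  assumes S: "S \<subseteq> {1..n div 2}" and d: "circ_diff n S d" and tors: "[3 * d = 0] (mod int n)"
  obtains m where "m \<in> S" "n = 3 * m" "[d = int m] (mod int n) \<or> [d = - int m] (mod int n)"
proof -
  obtain s where s: "s \<in> S" "[d = int s] (mod int n) \<or> [d = - int s] (mod int n)"
    using d by (auto simp: circ_diff_def)
  have "[3 * d = 3 * int s] (mod int n) \<or> [3 * d = - (3 * int s)] (mod int n)"
    using s(2) cong_scalar_left[of d _ "int n" 3] by fastforce
  then have "[3 * int s = 0] (mod int n)"
    using tors by (metis cong_0_iff cong_dvd_iff dvd_minus_iff)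
  then have "int n dvd int (3 * s)"
    by (simp add: cong_0_iff)
  then have "n dvd 3 * s"
    by (simp only: int_dvd_int_iff)
  then obtain k where k: "3 * s = n * k" ..
  have "s \<in> {1..n div 2}"
    using S s(1) by blast
  then have "1 \<le> s" "2 * s \<le> n"
    by auto
  then have "\<not> 2 \<le> k"
    using k mult_le_mono2[of 2 k n] by linarith
  moreover have "k \<noteq> 0"
    using k \<open>1 \<le> s\<close> by (cases k) auto
  ultimately have "k = 1" by linarith
  with k have "n = 3 * s" by simp
  then show thesis
    using s that by blast
qed

lemma vertices_circulant: "n \<ge> 1 \<Longrightarrow> vertices (circulant n S) = {0..<int n}"
  by (simp add: circulant_def cayley_graph_def Let_def carrier_integer_mod_group)

lemma edges_circulant_subset:
  assumes "E \<in> edges (circulant n S)"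
  obtains u w where "E = {u, w}" "u \<in> vertices (circulant n S)" "w \<in> vertices (circulant n S)"
  using assms by (auto simp: circulant_def cayley_graph_def Let_def)

lemma edges_circulant_iff:
  assumes "n \<ge> 2" "S \<subseteq> {1..n div 2}" "u \<in> {0..<int n}" "w \<in> {0..<int n}"
  shows "{u, w} \<in> edges (circulant n S) \<longleftrightarrow> circ_diff n S (w - u)"
  using circulant_adjacent_iff[OF assms] by (simp add: circ_diff_def)

section \<open>Ordered pairs of adjacent neighbours\<close>

text \<open>The last difference is \<open>v - w\<close> and not \<open>w - v\<close>, so that the
  three differences sum to zero and can be rotated; the sign does not affect
  \<open>circ_diff\<close>.\<close>

definition circ_pairs :: "nat \<Rightarrow> nat set \<Rightarrow> int \<Rightarrow> (int \<times> int) set" where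
  "circ_pairs n S v = {(u, w). u \<in> {0..<int n} \<and> w \<in> {0..<int n} \<and>
     circ_diff n S (u - v) \<and> circ_diff n S (w - u) \<and> circ_diff n S (v - w)}"

text \<open>The conditions say that \<open>u\<close> and \<open>w\<close> are adjacent neighbours of
  \<open>v\<close>. Without loops, each edge is counted once in each direction.\<close>

lemma card_circ_pairs:
  assumes n: "n \<ge> 2" and S: "S \<subseteq> {1..n div 2}" and v: "v \<in> {0..<int n}"
  shows "card (circ_pairs n S v) = 2 * neighbourhood_edges (circulant n S) v"
proof -
  let ?G = "circulant n S"
  let ?F = "edges (induced_subgraph ?G (open_neighbourhood ?G v))"
  have V: "vertices ?G = {0..<int n}"
    using n by (simp add: vertices_circulant)
  have N: "u \<in> open_neighbourhood ?G v \<longleftrightarrow> u \<in> {0..<int n} \<and> circ_diff n S (u - v)" for u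
    using edges_circulant_iff[OF n S v] by (auto simp: open_neighbourhood_def V)
  have sym: "circ_diff n S (w - v) \<longleftrightarrow> circ_diff n S (v - w)" for w
    using circ_diff_minus[of n S "w - v"] by simp
  have "{(u, w). {u, w} \<in> ?F} = circ_pairs n S v"
    using edges_circulant_iff[OF n S]
    by (auto simp: induced_subgraph_def circ_pairs_def N sym)
  moreover have "card {(u, w). {u, w} \<in> ?F} = 2 * card ?F"
  proof (rule card_ordered_pairs_eq_twice)
    have "?F \<subseteq> Pow {0..<int n}"
      using N by (auto simp: induced_subgraph_def)
    then show "finite ?F"
      by (rule finite_subset) simp
    show "card E = 2" if "E \<in> ?F" for E
    proof -
      have E: "E \<in> edges ?G"
        using that by (simp add: induced_subgraph_def)
      then obtain u w where uw: "E = {u, w}" "u \<in> {0..<int n}" "w \<in> {0..<int n}"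
        by (metis V edges_circulant_subset)
      have "u \<noteq> w"
        using E edges_circulant_iff[OF n S uw(2,3)] not_circ_diff_0[OF S] uw(1) by auto
      with uw show ?thesis by simp
    qed
  qed
  ultimately show ?thesis
    by (simp add: neighbourhood_edges_def)
qed

section \<open>The rotation of order three and its fixed points\<close>

text \<open>The map \<open>(x, y, z) \<mapsto> (y, z, x)\<close> in terms of \<open>u = v + x\<close> and \<open>w = v - z\<close>.\<close>

definition rotate_pair :: "nat \<Rightarrow> int \<Rightarrow> int \<times> int \<Rightarrow> int \<times> int" where
  "rotate_pair n v = (\<lambda>(u, w). ((v + w - u) mod int n, (2 * v - u) mod int n))"

lemma rotate_pair_mod:
  "rotate_pair n v (a mod int n, b mod int n) = rotate_pair n v (a, b)"
  by (simp add: rotate_pair_def mod_simps mod_diff_cong[OF mod_add_right_eq refl])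

text \<open>Modulo \<open>n\<close>, the differences of the new pair are those of the old one in
  cyclic order, so the three conditions are merely permuted.\<close>

lemma rotate_pair_in_circ_pairs:
  assumes n: "n \<ge> 1" and p: "p \<in> circ_pairs n S v"
  shows "rotate_pair n v p \<in> circ_pairs n S v"
proof -
  obtain u w where p_eq: "p = (u, w)" by (cases p)
  let ?u = "(v + w - u) mod int n" and ?w = "(2 * v - u) mod int n"
  have "[?u - v = w - u] (mod int n)" "[?w - ?u = v - w] (mod int n)"
    "[v - ?w = u - v] (mod int n)"
    unfolding cong_def mod_simps by (simp_all add: algebra_simps)
  then show ?thesis
    using n p circ_diff_cong[of _ _ n S]
    by (simp add: p_eq circ_pairs_def rotate_pair_def)
qed

lemma rotate_pair_order_three:
  assumes "u \<in> {0..<int n}" "w \<in> {0..<int n}"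
  shows "rotate_pair n v (rotate_pair n v (rotate_pair n v (u, w))) = (u, w)"
proof -
  have step: "rotate_pair n v (a, b) = ((v + b - a) mod int n, (2 * v - a) mod int n)" for a b
    by (simp add: rotate_pair_def)
  have "rotate_pair n v (rotate_pair n v (rotate_pair n v (u, w))) = (u mod int n, w mod int n)"
    \<comment> \<open>Modulo \<open>n\<close> the pair passes through
      \<open>(v + w - u, 2 * v - u)\<close> and \<open>(2 * v - w, v + u - w)\<close> before
      returning to \<open>(u, w)\<close>.\<close>
    by (simp only: step[of u w] rotate_pair_mod) (simp add: step rotate_pair_mod algebra_simps)
  with assms show ?thesis by simp
qed

text \<open>A fixed triple has \<open>x = y = z\<close>; as the sum is zero, this amounts to
  \<open>3 * x = 0\<close> and \<open>z = x\<close> modulo \<open>n\<close>.\<close>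

lemma rotate_pair_fixpoint_iff:
  assumes "u \<in> {0..<int n}" "w \<in> {0..<int n}"
  shows "rotate_pair n v (u, w) = (u, w) \<longleftrightarrow>
    [3 * (u - v) = 0] (mod int n) \<and> [w - v = v - u] (mod int n)"
proof -
  have "rotate_pair n v (u, w) = (u, w) \<longleftrightarrow>
      [v + w - u = u] (mod int n) \<and> [2 * v - u = w] (mod int n)"
    using assms by (auto simp: rotate_pair_def cong_def)
  also have "\<dots> \<longleftrightarrow> int n dvd v + w - 2 * u \<and> int n dvd 2 * v - u - w"
    by (simp add: cong_iff_dvd_diff algebra_simps)
  also have "\<dots> \<longleftrightarrow> int n dvd 3 * (u - v) \<and> int n dvd 2 * v - u - w"
  proof -
    \<comment> \<open>Up to sign, \<open>3 * (u - v)\<close> is the sum of both dividends, so it can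
      replace the first one in the presence of the second.\<close>
    have "3 * (u - v) = - ((v + w - 2 * u) + (2 * v - u - w))"
      by simp
    then show ?thesis
      by (metis dvd_add_left_iff dvd_minus_iff)
  qed
  also have "int n dvd 2 * v - u - w \<longleftrightarrow> int n dvd w - v - (v - u)"
    by (subst dvd_minus_iff[symmetric]) (simp add: algebra_simps)
  finally show ?thesis
    by (simp add: cong_iff_dvd_diff)
qed

lemma rotate_pair_fixpoints_empty:
  assumes S: "S \<subseteq> {1..n div 2}" and none: "\<And>m. m \<in> S \<Longrightarrow> n \<noteq> 3 * m"
  shows "{p \<in> circ_pairs n S v. rotate_pair n v p = p} = {}"
proof -
  have False if "(u, w) \<in> circ_pairs n S v" "rotate_pair n v (u, w) = (u, w)" for u w
  proof -
    have "circ_diff n S (u - v)" "[3 * (u - v) = 0] (mod int n)"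
      using that rotate_pair_fixpoint_iff[of u n w v] by (simp_all add: circ_pairs_def)
    then show False
      using circ_diff_three_torsion[OF S] none by metis
  qed
  then show ?thesis by auto
qed

text \<open>A fixed triple is constant with value \<open>a\<close>, where \<open>a\<close> is
  \<open>m\<close> or \<open>- m\<close> modulo \<open>n\<close>, and its pair is
  \<open>u = v + a\<close>, \<open>w = v - a\<close>.\<close>

lemma rotate_pair_fixpoints_third:
  assumes S: "S \<subseteq> {1..n div 2}" and m: "m \<in> S" and n: "n = 3 * m"
  shows "{p \<in> circ_pairs n S v. rotate_pair n v p = p} =
    {((v + int m) mod int n, (v - int m) mod int n), ((v - int m) mod int n, (v + int m) mod int n)}"
    (is "?F = {?p, ?q}")
proof
  have pos: "n > 0"
    using S m n by auto
  show "?F \<subseteq> {?p, ?q}"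
  proof
    fix p assume "p \<in> ?F"
    moreover obtain u w where p: "p = (u, w)" by (cases p)
    ultimately have uw: "u \<in> {0..<int n}" "w \<in> {0..<int n}" and d: "circ_diff n S (u - v)"
      and fixp: "[3 * (u - v) = 0] (mod int n)" "[w - v = v - u] (mod int n)"
      using rotate_pair_fixpoint_iff[of u n w v] by (simp_all add: circ_pairs_def)
    obtain m' where "n = 3 * m'" "[u - v = int m'] (mod int n) \<or> [u - v = - int m'] (mod int n)"
      using circ_diff_three_torsion[OF S d fixp(1)] by metis
    then have "[u - v = int m] (mod int n) \<or> [u - v = - int m] (mod int n)"
      using n by simp
    moreover have "u = (v + a) mod int n \<and> w = (v - a) mod int n"
      if "[u - v = a] (mod int n)" for a
    proof -
      have "[u = v + a] (mod int n)"
        using cong_add[OF that cong_refl[of v]] by (simp add: add.commute)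
      moreover have "[v - u = - a] (mod int n)"
        using that cong_minus_minus_iff[of "u - v" a "int n"] by simp
      then have "[w - v = - a] (mod int n)"
        using fixp(2) cong_trans by blast
      then have "[w = v - a] (mod int n)"
        using cong_add[of "w - v" "- a" "int n" v v] by simp
      ultimately show ?thesis
        using uw by (simp add: cong_def)
    qed
    ultimately show "p \<in> {?p, ?q}"
      unfolding p by fastforce
  qed
  have "((v + a) mod int n, (v - a) mod int n) \<in> ?F" if a: "a = int m \<or> a = - int m" for a
  proof -
    let ?u = "(v + a) mod int n" and ?w = "(v - a) mod int n"
    have n_a: "[3 * a = 0] (mod int n)"
      using a n by (auto simp: cong_0_iff)
    have in_range: "?u \<in> {0..<int n}" "?w \<in> {0..<int n}"
      using pos by simp_all
    \<comment> \<open>The difference \<open>- 2 * a\<close> is written as \<open>a - 3 * a\<close>,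
      because \<open>3 * a\<close> vanishes modulo \<open>n\<close>.\<close>
    have diffs: "[?u - v = a] (mod int n)" "[?w - ?u = a - 3 * a] (mod int n)"
      "[v - ?w = a] (mod int n)" "[?w - v = - a] (mod int n)" "[v - ?u = - a] (mod int n)"
      unfolding cong_def mod_simps by (simp_all add: algebra_simps)
    have "[a - 3 * a = a] (mod int n)"
      using cong_diff[OF cong_refl[of a] n_a] by simp
    then have mid: "[?w - ?u = a] (mod int n)"
      using diffs(2) cong_trans by blast
    have "circ_diff n S a"
      unfolding circ_diff_def using a m cong_refl by blast
    then have "(?u, ?w) \<in> circ_pairs n S v"
      using in_range circ_diff_cong[OF diffs(1), of S] circ_diff_cong[OF diffs(3), of S]
        circ_diff_cong[OF mid, of S]
      by (simp add: circ_pairs_def)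
    moreover have "[3 * (?u - v) = 0] (mod int n)"
      using cong_scalar_left[OF diffs(1), of 3] n_a cong_trans by blast
    moreover have "[?w - v = v - ?u] (mod int n)"
      using diffs(4,5) cong_trans cong_sym by blast
    ultimately show ?thesis
      using rotate_pair_fixpoint_iff[OF in_range] by simp
  qed
  from this[of "int m"] this[of "- int m"] show "{?p, ?q} \<subseteq> ?F"
    by simp
qed

section \<open>The residue of the edge count modulo three\<close>

theorem theorem3p2:
  fixes n :: nat and S :: "nat set" and v :: int
  assumes "n \<ge> 2"
    and "S \<subseteq> {1..n div 2}"
    and "v \<in> vertices (circulant n S)"
  shows "if [n = 0] (mod 3) \<and> n div 3 \<in> S
         then [neighbourhood_edges (circulant n S) v = 1] (mod 3)
         else [neighbourhood_edges (circulant n S) v = 0] (mod 3)"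
proof -
  let ?e = "neighbourhood_edges (circulant n S) v"
  let ?F = "{p \<in> circ_pairs n S v. rotate_pair n v p = p}"
  have v: "v \<in> {0..<int n}"
    using assms(1,3) by (simp add: vertices_circulant)
  have "finite (circ_pairs n S v)"
    by (rule finite_subset[of _ "{0..<int n} \<times> {0..<int n}"]) (auto simp: circ_pairs_def)
  then have "[card (circ_pairs n S v) = card ?F] (mod 3)"
  proof (rule card_cong_fixpoints_order_three)
    show "rotate_pair n v p \<in> circ_pairs n S v" if "p \<in> circ_pairs n S v" for p
      using rotate_pair_in_circ_pairs[OF _ that] assms(1) by simp
    show "rotate_pair n v (rotate_pair n v (rotate_pair n v p)) = p"
      if "p \<in> circ_pairs n S v" for p
      using that by (auto simp: circ_pairs_def intro!: rotate_pair_order_three)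
  qed
  \<comment> \<open>Since 2 is invertible modulo 3, this determines the residue of
    \<open>?e\<close>: two fixed pairs give 1, none gives 0.\<close>
  then have e: "[2 * ?e = card ?F] (mod 3)"
    using card_circ_pairs[OF assms(1,2) v] by simp
  show ?thesis
  proof (cases "[n = 0] (mod 3) \<and> n div 3 \<in> S")
    case True
    define m where "m = n div 3"
    have m: "m \<in> S" "n = 3 * m"
      using True by (auto simp: m_def cong_def)
    \<comment> \<open>The two fixed pairs are distinct: otherwise \<open>n = 3 * m\<close> would
      divide the smaller positive number \<open>2 * m\<close>.\<close>
    have "\<not> [v + int m = v - int m] (mod int n)"
    proof
      assume "[v + int m = v - int m] (mod int n)"
      then have "int n dvd int (2 * m)"
        by (simp add: cong_iff_dvd_diff)
      then have "n dvd 2 * m"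
        by (simp only: int_dvd_int_iff)
      then show False
        using dvd_imp_le[of n "2 * m"] m(2) assms(1) by simp
    qed
    then have "card ?F = 2"
      unfolding rotate_pair_fixpoints_third[OF assms(2) m] by (simp add: cong_def)
    with e have "[?e = 1] (mod 3)"
      unfolding cong_def by presburger
    with True show ?thesis by simp
  next
    case False
    have "n \<noteq> 3 * m" if "m \<in> S" for m
      using False that by (auto simp: cong_def)
    then have "?F = {}"
      by (rule rotate_pair_fixpoints_empty[OF assms(2)])
    then have "card ?F = 0"
      by (simp only: card.empty)
    with e have "[?e = 0] (mod 3)"
      unfolding cong_def by presburger
    with False show ?thesis by (simp only: if_False)
  qed
qed

end
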